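(* For every integer $k\ge 1$ and every nonzero $n\in\mathbb{Z}[\zeta_k]$, \[ 3\log_3 |n| \le ||n||_k . \]
   Context: An expression is a formal term built from the symbol $x$ using the binary operations $+$ and $\cdot$ (with parentheses); its size is the number of occurrences of $x$ in it. For an integer $k\ge1$ let $\zeta_k=e^{2\pi i/k}$. For $\alpha\in\mathbb{Z}[\zeta_k]$, $||\alpha||_k$ (the complexity of $\alpha$ with base $\zeta_k$) is the minimum size of an expression which evaluates to $\alpha$ when $x=\zeta_k$ (taken to be $+\infty$ if no such expression exists, which can only happen for $k=1$). $|n|$ denotes the complex absolute value. *)

theory Defs
  imports "HOL-Analysis.Analysis" "HOL-Library.Extended_Real"
    "HOL-Computational_Algebra.Polynomial"
begin

datatype expr = X | Plus expr expr | Times expr expr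

primrec num_X :: "expr \<Rightarrow> nat" where
  "num_X X = 1"
| "num_X (Plus e f) = num_X e + num_X f"
| "num_X (Times e f) = num_X e + num_X f"

primrec expr_val :: "complex \<Rightarrow> expr \<Rightarrow> complex" where
  "expr_val x X = x"
| "expr_val x (Plus e f) = expr_val x e + expr_val x f"
| "expr_val x (Times e f) = expr_val x e * expr_val x f"

definition zeta :: "nat \<Rightarrow> complex" where
  "zeta k = exp (2 * of_real pi * \<i> / of_nat k)"

definition int_adjoin :: "complex \<Rightarrow> complex set" where
  "int_adjoin z = {poly (map_poly of_int p) z | p :: int poly. True}"

(* The infimum in enat is a minimum if some expression evaluates to a,
   and is infinity if there is none; see the two lemmas below. *)
definition complexity :: "nat \<Rightarrow> complex \<Rightarrow> enat" where
  "complexity k a = (INF e\<in>{e. expr_val (zeta k) e = a}. enat (num_X e))"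

lemma complexity_attained:
  assumes "expr_val (zeta k) e0 = a"
  shows "\<exists>e. expr_val (zeta k) e = a \<and> complexity k a = enat (num_X e)
    \<and> (\<forall>f. expr_val (zeta k) f = a \<longrightarrow> num_X e \<le> num_X f)"
proof -
  obtain e where e: "expr_val (zeta k) e = a"
    and least: "\<And>f. expr_val (zeta k) f = a \<Longrightarrow> num_X e \<le> num_X f"
    using ex_has_least_nat[of "\<lambda>e. expr_val (zeta k) e = a" e0 num_X] assms by blast
  have "complexity k a = enat (num_X e)"
    unfolding complexity_def
    by (rule antisym) (auto intro!: INF_lower2[OF _ order_refl] INF_greatest simp: e least)
  with e least show ?thesis by blast
qed

lemma complexity_infinity:
  assumes "\<nexists>e. expr_val (zeta k) e = a"
  shows "complexity k a = \<infinity>"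
  using assms by (simp add: complexity_def top_enat_def)

end

theory Submission
  imports Defs
begin

text \<open>
  By induction on the expression, an expression of size \<open>s\<close> evaluated at a point of the closed unit
  disc has absolute value at most \<open>3 powr (s / 3)\<close>. Products are immediate, and if both bounds \<open>a\<close>,
  \<open>b\<close> are at least \<open>2\<close>, then \<open>a + b \<le> a * b\<close> settles sums. Since \<open>3 powr (1/3) < 2\<close> and
  \<open>1 + 3 powr (2/3) > 3\<close>, sums with a summand of size \<open>1\<close> only work out because the induction
  carries along the sharper bounds \<open>1\<close> and \<open>2\<close> for sizes \<open>1\<close> and \<open>2\<close>.
\<close>

lemma num_X_pos: "num_X e \<ge> 1"
  by (induction e) auto

definition size_bound :: "nat \<Rightarrow> real" where
  "size_bound n = (if n = 1 then 1 else if n = 2 then 2 else 3 powr (n / 3))"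

text \<open>Cubing reduces this to 8 < 9.\<close>

lemma two_less_powr: "2 < (3::real) powr (2/3)"
proof (rule power_less_imp_less_base[of _ 3])
  have "((3::real) powr (2/3)) ^ 3 = 3 powr 2"
    by (simp add: powr_powr flip: powr_realpow)
  then show "(2::real) ^ 3 < (3 powr (2/3)) ^ 3" by simp
qed simp

lemma size_bound_le_powr: "size_bound n \<le> 3 powr (n / 3)"
  using two_less_powr ge_one_powr_ge_zero[of 3 "1/3"] by (simp add: size_bound_def)

lemma size_bound_eq_powr: "n \<ge> 3 \<Longrightarrow> size_bound n = 3 powr (n / 3)"
  by (simp add: size_bound_def)

lemma size_bound_ge_1: "n \<ge> 1 \<Longrightarrow> size_bound n \<ge> 1"
  by (simp add: size_bound_def ge_one_powr_ge_zero)

lemma size_bound_ge_3: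
  assumes "n \<ge> 3"
  shows "size_bound n \<ge> 3"
  using powr_mono[of 1 "n / 3" 3] assms by (simp add: size_bound_eq_powr)

lemma size_bound_ge_2:
  assumes "n \<ge> 2"
  shows "size_bound n \<ge> 2"
proof (cases "n = 2")
  case False
  with assms have "n \<ge> 3" by simp
  with size_bound_ge_3[of n] show ?thesis by simp
qed (simp add: size_bound_def)

lemma size_bound_mult:
  assumes "m \<ge> 1" "n \<ge> 1"
  shows "size_bound m * size_bound n \<le> size_bound (m + n)"
proof (cases "m + n = 2")
  case True
  with assms have "m = 1" "n = 1" by auto
  then show ?thesis by (simp add: size_bound_def)
next
  \<comment> \<open>Now the total is at least 3, so the target bound is a pure power of 3 and the
    exponents simply add.\<close>
  case False
  have "size_bound m * size_bound n \<le> 3 powr (m / 3) * 3 powr (n / 3)"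
    using size_bound_ge_1[OF assms(1)] size_bound_ge_1[OF assms(2)]
    by (intro mult_mono size_bound_le_powr) auto
  also have "\<dots> = 3 powr ((m + n) / 3)"
    by (simp add: add_divide_distrib flip: powr_add)
  also have "\<dots> = size_bound (m + n)"
    using False assms by (simp add: size_bound_eq_powr)
  finally show ?thesis .
qed

text \<open>Sizes 1 and 2 give equality. From 3 on, one more unit multiplies the bound by
  \<open>3 powr (1/3)\<close>, at least 4/3, and a third of a bound that is at least 3 pays for the
  added 1.\<close>

lemma size_bound_Suc:
  assumes "n \<ge> 1"
  shows "1 + size_bound n \<le> size_bound (Suc n)"
proof -
  consider "n = 1" | "n = 2" | "n \<ge> 3" using assms by linarith
  then show ?thesis
  proof cases
    case 3
    have third: "4 / 3 \<le> (3::real) powr (1/3)"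
    \<comment> \<open>The rule uses the exponent \<open>Suc n\<close>, so 2 means cubing: 64/27 is
      at most 3.\<close>
    proof (rule power_le_imp_le_base[of _ 2])
      have "((3::real) powr (1/3)) ^ 3 = 3"
        by (simp add: powr_powr flip: powr_realpow)
      then show "(4 / 3 :: real) ^ Suc 2 \<le> (3 powr (1/3)) ^ Suc 2"
        by (simp add: power_divide)
    qed simp
    have "1 + size_bound n \<le> 4 / 3 * size_bound n"
      using size_bound_ge_3[OF 3] by simp
    also have "\<dots> \<le> 3 powr (1/3) * size_bound n"
      using third size_bound_ge_3[OF 3] by (intro mult_right_mono) auto
    also have "\<dots> = size_bound (Suc n)"
      using 3 by (simp add: size_bound_eq_powr add_divide_distrib flip: powr_add)
    finally show ?thesis .
  qed (simp_all add: size_bound_def)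
qed

lemma size_bound_add:
  assumes "m \<ge> 1" "n \<ge> 1"
  shows "size_bound m + size_bound n \<le> size_bound (m + n)"
proof -
  consider "m = 1" | "n = 1" | "m \<ge> 2" "n \<ge> 2" using assms by linarith
  then show ?thesis
  proof cases
    case 1
    then show ?thesis using size_bound_Suc[OF assms(2)] by (simp add: size_bound_def)
  next
    case 2
    then show ?thesis using size_bound_Suc[OF assms(1)] by (simp add: size_bound_def)
  next
    case 3
    \<comment> \<open>With \<open>a\<close>, \<open>b\<close> for the two bounds, the right-hand
      side expands to \<open>a * b - a - b\<close>.\<close>
    have "0 \<le> (size_bound m - 2) * (size_bound n - 1) + (size_bound n - 2)"
      using size_bound_ge_2[OF 3(1)] size_bound_ge_2[OF 3(2)] by simp
    then have "size_bound m + size_bound n \<le> size_bound m * size_bound n"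
      by (simp add: algebra_simps)
    with size_bound_mult[OF assms] show ?thesis by simp
  qed
qed

lemma norm_expr_val_le_size_bound:
  assumes "cmod x \<le> 1"
  shows "cmod (expr_val x e) \<le> size_bound (num_X e)"
proof (induction e)
  case X
  with assms show ?case by (simp add: size_bound_def)
next
  case (Plus e f)
  have "cmod (expr_val x e + expr_val x f) \<le> size_bound (num_X e) + size_bound (num_X f)"
    by (rule norm_triangle_mono[OF Plus])
  with size_bound_add[OF num_X_pos num_X_pos, of e f] show ?case by simp
next
  case (Times e f)
  have "cmod (expr_val x e * expr_val x f) \<le> size_bound (num_X e) * size_bound (num_X f)"
    using mult_mono'[OF Times] by (simp add: norm_mult)
  with size_bound_mult[OF num_X_pos num_X_pos, of e f] show ?case by simp
qed

lemma three_log_norm_expr_val_le: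
  assumes "cmod x \<le> 1" and "expr_val x e \<noteq> 0"
  shows "3 * log 3 (cmod (expr_val x e)) \<le> num_X e"
proof -
  have "cmod (expr_val x e) \<le> 3 powr (num_X e / 3)"
    using norm_expr_val_le_size_bound[OF assms(1)] size_bound_le_powr by (rule order_trans)
  \<comment> \<open>A nonzero value has positive modulus, as the logarithm requires.\<close>
  with assms(2) have "log 3 (cmod (expr_val x e)) \<le> num_X e / 3"
    by (subst log_le_iff) auto
  then show ?thesis by simp
qed

text \<open>The exponent is purely imaginary.\<close>

lemma norm_zeta: "cmod (zeta k) = 1"
  by (simp add: zeta_def norm_exp_eq_Re)

theorem theorem2p3:
  fixes k :: nat and n :: complex
  assumes "k \<ge> 1" and "n \<in> int_adjoin (zeta k)" and "n \<noteq> 0"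
  shows "ereal (3 * log 3 (cmod n)) \<le> ereal_of_enat (complexity k n)"
proof (cases "\<exists>e. expr_val (zeta k) e = n")
  case True
  then obtain e where "expr_val (zeta k) e = n" and "complexity k n = enat (num_X e)"
    using complexity_attained by blast
  with three_log_norm_expr_val_le[of "zeta k" e] assms(3) show ?thesis
    by (simp add: norm_zeta)
next
  case False
  \<comment> \<open>The infimum over no expressions is infinite, so the bound is trivial.\<close>
  then show ?thesis by (simp add: complexity_infinity)
qed

end
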